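(* Let $n\ge 1$ be an integer and let $x_1,\dots,x_n,a,t$ be complex numbers with $|x_1|,\dots,|x_n|<1$, $|a|<1$ and $|t|<1$. Then $$\prod_{\alpha_1,\alpha_2,\dots,\alpha_n\ge 0}\frac{1-x_1^{\alpha_1}x_2^{\alpha_2}\cdots x_n^{\alpha_n}\,a\,t}{1-x_1^{\alpha_1}x_2^{\alpha_2}\cdots x_n^{\alpha_n}\,t}=\sum_{k=0}^{\infty}A_k\,t^k,$$ where $A_0=1$ and, for every $k\ge 1$, $$A_k=\frac{1}{k!}\det(a_{ij})_{1\le i,j\le k},\qquad a_{ij}=\begin{cases}\dfrac{1-a^{\,i-j+1}}{(1-x_1^{\,i-j+1})(1-x_2^{\,i-j+1})\cdots(1-x_n^{\,i-j+1})}, & i\ge j,\\[2mm] -i, & i=j-1,\\ 0, & \text{otherwise.}\end{cases}$$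
   Context: The product runs over all $n$-tuples $(\alpha_1,\dots,\alpha_n)$ of non-negative integers, including the tuple with all entries zero; $x^0=1$ for every $x$ (including $x=0$). *)

theory Defs
  imports
    "HOL-Analysis.Analysis"
    "Jordan_Normal_Form.Determinant"
begin

text \<open>
  The library's \<open>has_prod\<close> is indexed by the natural numbers. The following is its unordered
  analogue over an arbitrary index set, related to it as \<open>has_sum\<close> is to \<open>sums\<close>:
  after removal of finitely many factors (which takes care of vanishing factors), the net of
  finite partial products converges to a nonzero limit.
\<close>

definition has_prod_on ::
    "('i \<Rightarrow> 'a :: {real_normed_field}) \<Rightarrow> 'a \<Rightarrow> 'i set \<Rightarrow> bool" where
  "has_prod_on f p S \<longleftrightarrow>
     (\<exists>F q. finite F \<and> F \<subseteq> S \<and> q \<noteq> 0 \<and>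
        (prod f \<longlongrightarrow> q) (finite_subsets_at_top (S - F)) \<and> p = prod f F * q)"

definition exponent_tuples :: "nat \<Rightarrow> (nat \<Rightarrow> nat) set" where
  "exponent_tuples n = {1..n} \<rightarrow>\<^sub>E UNIV"

definition a_entry :: "nat \<Rightarrow> (nat \<Rightarrow> complex) \<Rightarrow> complex \<Rightarrow> nat \<Rightarrow> nat \<Rightarrow> complex" where
  "a_entry n x a i j =
     (if i \<ge> j then (1 - a ^ (i - j + 1)) / (\<Prod>l = 1..n. 1 - x l ^ (i - j + 1))
      else if i + 1 = j then - of_nat i
      else 0)"

text \<open>
  Rows and columns of \<open>mat k k\<close> are indexed from 0, those of \<open>a_entry\<close> from 1. Since
  \<open>HOL-Analysis\<close> also has a constant \<open>det\<close>, for matrices whose size is given by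
  their type, the name is qualified.
\<close>

definition A_coeff :: "nat \<Rightarrow> (nat \<Rightarrow> complex) \<Rightarrow> complex \<Rightarrow> nat \<Rightarrow> complex" where
  "A_coeff n x a k =
     (if k = 0 then 1
      else 1 / fact k *
        Determinant.det (mat k k (\<lambda>(i, j). a_entry n x a (i + 1) (j + 1))))"

end

theory Submission
  imports Defs "HOL-Complex_Analysis.Laurent_Convergence"
begin

text \<open>
  Put \<open>m\<^sub>\<alpha> = x\<^sub>1\<^bsup>\<alpha>\<^sub>1\<^esup> \<cdots> x\<^sub>n\<^bsup>\<alpha>\<^sub>n\<^esup>\<close> and expand the logarithm of each factor into
  \<open>\<Sum>k\<ge>1. (1 - a^k) (m\<^sub>\<alpha> t)^k / k\<close>. The double series over \<open>\<alpha>\<close> and \<open>k\<close> converges absolutely, and summing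
  over \<open>\<alpha>\<close> first yields geometric series, so the product is \<open>exp (\<Sum>k\<ge>1. c\<^sub>k t^k / k)\<close> with
  \<open>c\<^sub>k = (1 - a^k) / ((1 - x\<^sub>1^k) \<cdots> (1 - x\<^sub>n^k))\<close>. This function is holomorphic in the unit disc, and its
  logarithmic derivative shows that its Taylor coefficients satisfy
  \<open>k A\<^sub>k = \<Sum>j<k. c\<^bsub>k-j\<^esub> A\<^sub>j\<close>, \<open>A\<^sub>0 = 1\<close>. Cramer's rule for this triangular system is the determinant formula.
\<close>

subsection \<open>Recurrences and Hessenberg determinants\<close>

text \<open>For F = exp(G), compare the coefficients of index \<open>m\<close> in F' = F * G'. The
  chain rule for formal composition requires a zero constant term in \<open>G\<close>.\<close>

lemma fps_exp_compose_nth_Suc: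
  fixes G :: "'a :: field_char_0 fps"
  assumes "fps_nth G 0 = 0"
  shows "of_nat (Suc m) * fps_nth (fps_exp 1 oo G) (Suc m) =
    (\<Sum>j\<le>m. of_nat (m - j + 1) * fps_nth G (m - j + 1) * fps_nth (fps_exp 1 oo G) j)"
proof -
  have "fps_deriv (fps_exp 1 oo G) = (fps_exp 1 oo G) * fps_deriv G"
    using fps_compose_deriv[OF assms, of "fps_exp 1"] by simp
  hence "fps_nth (fps_deriv (fps_exp 1 oo G)) m = fps_nth ((fps_exp 1 oo G) * fps_deriv G) m"
    by simp
  hence "of_nat (Suc m) * fps_nth (fps_exp 1 oo G) (Suc m) =
    (\<Sum>j\<le>m. fps_nth (fps_exp 1 oo G) j * (of_nat (m - j + 1) * fps_nth G (m - j + 1)))"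
    by (simp only: fps_mult_nth fps_deriv_nth atLeast0AtMost Suc_eq_plus1)
  thus ?thesis
    by (simp only: mult_ac)
qed

text \<open>A column operation turns column 0 into the matrix times (A_0, ..., A_{k-1}). By the
  recurrence only the bottom entry of the new column survives, and expanding along it leaves a
  triangular minor.\<close>

lemma det_hessenberg:
  fixes c A :: "nat \<Rightarrow> 'a :: {comm_ring_1, ring_char_0}"
  assumes "A 0 = 1"
    and rec: "\<And>m. of_nat (Suc m) * A (Suc m) = (\<Sum>j\<le>m. c (m - j + 1) * A j)"
  shows "Determinant.det (mat k k (\<lambda>(i, j).
    if j \<le> i then c (i - j + 1) else if i + 1 = j then - of_nat (i + 1) else 0)) = fact k * A k"
proof (cases k)
  case 0
  then show ?thesis by (simp add: assms)
next
  case (Suc l)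
  define M where "M = mat k k (\<lambda>(i, j).
    if j \<le> i then c (i - j + 1) else if i + 1 = j then - of_nat (i + 1) else 0)"
  \<comment> \<open>The identity with column 0 replaced by the values of \<open>A\<close>. Since
    \<open>A 0 = 1\<close>, it is unit lower triangular, so multiplying by it preserves the
    determinant.\<close>
  define P where "P = mat k k (\<lambda>(i, j). if j = 0 then A i else if i = j then 1 else 0)"
  have M: "M \<in> carrier_mat k k" and P: "P \<in> carrier_mat k k"
    by (auto simp: M_def P_def)
  \<comment> \<open>The entries up to the diagonal contribute (i+1) A_{i+1} by \<open>rec\<close>,
    and the superdiagonal entry -(i+1) cancels this. The last row \<open>l\<close> has no
    superdiagonal entry, so there the value k A_k remains.\<close>
  have MP_0: "(M * P) $$ (i, 0) = (if i = l then of_nat k * A k else 0)" if "i < k" for i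
  proof -
    have "(M * P) $$ (i, 0) = (\<Sum>j<k. M $$ (i, j) * A j)"
      using that Suc by (simp add: M_def P_def scalar_prod_def atLeast0LessThan)
    also have "\<dots> = (\<Sum>j\<le>i. M $$ (i, j) * A j) + (\<Sum>j\<in>{Suc i..<k}. M $$ (i, j) * A j)"
      using that by (subst sum.union_disjoint [symmetric]) (auto intro!: sum.cong)
    also have "(\<Sum>j\<le>i. M $$ (i, j) * A j) = of_nat (Suc i) * A (Suc i)"
      unfolding rec using that by (intro sum.cong) (auto simp: M_def)
    also have "(\<Sum>j\<in>{Suc i..<k}. M $$ (i, j) * A j) =
      (\<Sum>j\<in>{Suc i..<k}. if j = Suc i then - of_nat (Suc i) * A (Suc i) else 0)"
      by (intro sum.cong) (auto simp: M_def)
    also have "\<dots> = (if i = l then 0 else - of_nat (Suc i) * A (Suc i))"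
      using that Suc by (subst sum.delta) auto
    finally show ?thesis
      using Suc by (auto simp: algebra_simps)
  qed
  have MP_Suc: "(M * P) $$ (i, Suc j) = M $$ (i, Suc j)" if "i < k" "Suc j < k" for i j
  proof -
    have "(M * P) $$ (i, Suc j) = (\<Sum>r<k. M $$ (i, r) * (if r = Suc j then 1 else 0))"
      using that by (simp add: M_def P_def scalar_prod_def atLeast0LessThan)
    also have "\<dots> = (\<Sum>r<k. if r = Suc j then M $$ (i, Suc j) else 0)"
      by (intro sum.cong) auto
    also have "\<dots> = M $$ (i, Suc j)"
      using that by simp
    finally show ?thesis .
  qed
  have "Determinant.det P = prod_list (diag_mat P)"
    by (rule det_lower_triangular[OF _ P]) (auto simp: P_def)
  also have "\<dots> = 1"
    unfolding prod_list_diag_prod by (intro prod.neutral) (auto simp: P_def assms)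
  finally have det_P: "Determinant.det P = 1" .
  \<comment> \<open>Deleting the last row and column 0 moves the superdiagonal -1, ..., -l of
    \<open>M\<close> onto the diagonal.\<close>
  define D where "D = mat_delete (M * P) l 0"
  have D: "D \<in> carrier_mat l l"
    using mat_delete_carrier[of "M * P" k k] M P Suc by (auto simp: D_def)
  have D_nth: "D $$ (i, j) = M $$ (i, Suc j)" if "i < l" "j < l" for i j
    using that Suc M P MP_Suc[of i j] by (simp add: D_def mat_delete_def)
  have "Determinant.det D = prod_list (diag_mat D)"
    by (rule det_lower_triangular[OF _ D]) (use D_nth Suc in \<open>auto simp: M_def\<close>)
  also have "\<dots> = (\<Prod>i<l. - of_nat (Suc i))"
    unfolding prod_list_diag_prod atLeast0LessThan
    by (rule prod.cong) (use D D_nth Suc in \<open>auto simp: M_def\<close>)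
  also have "\<dots> = (\<Prod>i<l. (-1) * of_nat (Suc i))"
    by simp
  also have "\<dots> = (-1) ^ l * fact l"
    unfolding prod.distrib by (simp add: fact_prod_Suc atLeast0LessThan)
  finally have det_D: "Determinant.det D = (-1) ^ l * fact l" .
  have "Determinant.det M = Determinant.det (M * P)"
    using det_mult[OF M P] det_P by simp
  also have "\<dots> = (\<Sum>i<k. (M * P) $$ (i, 0) * cofactor (M * P) i 0)"
    using M P Suc by (intro laplace_expansion_column) auto
  also have "\<dots> = (\<Sum>i<k. if i = l then of_nat k * A k * cofactor (M * P) l 0 else 0)"
    by (intro sum.cong) (auto simp: MP_0)
  also have "\<dots> = of_nat k * A k * ((-1) ^ l * Determinant.det D)"
    using Suc by (simp add: cofactor_def D_def)
  \<comment> \<open>The cofactor sign cancels the sign of det D, and k * l! = k! because k = l +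
    1.\<close>
  also have "\<dots> = of_nat k * A k * (((-1) * (-1)) ^ l * fact l)"
    unfolding det_D power_mult_distrib by (simp only: mult.assoc)
  also have "\<dots> = fact k * A k"
    by (simp add: Suc algebra_simps)
  finally show ?thesis
    by (simp add: M_def)
qed

subsection \<open>The logarithm of the product\<close>

text \<open>A finite product of absolutely convergent geometric series may be multiplied out into
  one sum over all exponent tuples.\<close>

lemma has_sum_prod_geometric:
  fixes x :: "'i \<Rightarrow> 'a :: {real_normed_field, banach}"
  assumes "finite I" "\<And>i. i \<in> I \<Longrightarrow> norm (x i) < 1"
  shows "((\<lambda>\<alpha>. \<Prod>i\<in>I. x i ^ \<alpha> i) has_sum (\<Prod>i\<in>I. 1 / (1 - x i))) (I \<rightarrow>\<^sub>E UNIV)"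
proof -
  have geo: "((\<lambda>k. x i ^ k) has_sum (1 / (1 - x i))) UNIV" if "i \<in> I" for i
    using assms(2)[OF that]
    by (intro norm_summable_imp_has_sum geometric_sums)
       (auto simp: norm_power intro!: summable_geometric)
  have abs: "(\<lambda>k. norm (x i ^ k)) summable_on UNIV" if "i \<in> I" for i
    using assms(2)[OF that]
    by (intro norm_summable_imp_summable_on) (auto simp: norm_power intro!: summable_geometric)
  have "infsum (\<lambda>\<alpha>. \<Prod>i\<in>I. x i ^ \<alpha> i) (I \<rightarrow>\<^sub>E UNIV) = (\<Prod>i\<in>I. infsum (\<lambda>k. x i ^ k) UNIV)"
    by (rule infsum_prod_PiE_abs) (use assms(1) abs in auto)
  also have "\<dots> = (\<Prod>i\<in>I. 1 / (1 - x i))"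
    by (intro prod.cong refl infsumI geo)
  finally have eq: "infsum (\<lambda>\<alpha>. \<Prod>i\<in>I. x i ^ \<alpha> i) (I \<rightarrow>\<^sub>E UNIV) = (\<Prod>i\<in>I. 1 / (1 - x i))" .
  \<comment> \<open>A divergent family has \<open>infsum\<close> equal to 0, so a nonzero value implies summability.\<close>
  have "1 - x i \<noteq> 0" if "i \<in> I" for i
    using assms(2)[OF that] by auto
  hence "(\<Prod>i\<in>I. 1 / (1 - x i)) \<noteq> 0"
    using assms(1) by (simp add: prod_zero_iff)
  hence "(\<lambda>\<alpha>. \<Prod>i\<in>I. x i ^ \<alpha> i) summable_on (I \<rightarrow>\<^sub>E UNIV)"
    using eq infsum_not_exists[of "\<lambda>\<alpha>. \<Prod>i\<in>I. x i ^ \<alpha> i" "I \<rightarrow>\<^sub>E UNIV"] by argo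
  thus ?thesis
    using eq has_sum_infsum[of "\<lambda>\<alpha>. \<Prod>i\<in>I. x i ^ \<alpha> i" "I \<rightarrow>\<^sub>E UNIV"] by simp
qed

lemma has_sum_Ln_series:
  assumes "norm z < 1"
  shows "((\<lambda>k. z ^ Suc k / of_nat (Suc k)) has_sum (- Ln (1 - z))) UNIV"
proof (rule norm_summable_imp_has_sum)
  show "summable (\<lambda>k. norm (z ^ Suc k / of_nat (Suc k)))"
  proof (rule summable_comparison_test')
    show "summable (\<lambda>k. norm z ^ k)"
      using assms by (intro summable_geometric) auto
    show "norm (norm (z ^ Suc k / of_nat (Suc k))) \<le> norm z ^ k" if "k \<ge> 0" for k
    proof -
      have "norm z * norm z ^ k \<le> norm z ^ k * (1 + real k)"
        using assms by (subst mult.commute, intro mult_left_mono) auto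
      thus ?thesis
        by (simp add: norm_divide norm_mult norm_power divide_simps mult_ac del: of_nat_Suc)
           (simp add: mult_ac)
    qed
  qed
  have "(\<lambda>k. - (z ^ k) / of_nat k) sums Ln (1 - z)"
    using Ln_series'[of "-z"] assms by simp
  \<comment> \<open>The dropped term at index 0 is -1/0, which is 0 by the convention for
    division.\<close>
  hence "(\<lambda>k. - (z ^ Suc k) / of_nat (Suc k)) sums Ln (1 - z)"
    by (subst sums_Suc_iff) simp
  from sums_minus[OF this] show "(\<lambda>k. z ^ Suc k / of_nat (Suc k)) sums (- Ln (1 - z))"
    by simp
qed

text \<open>Both sums are iterated forms of one absolutely convergent double series, so they share
  the value \<open>S\<close>. The existential statement ties the product side to the power series
  side.\<close>

lemma has_sum_Ln_factors:
  fixes x :: "'i \<Rightarrow> complex"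
  assumes "finite I" "\<And>i. i \<in> I \<Longrightarrow> norm (x i) < 1" "norm a < 1" "norm t < 1"
  defines "c \<equiv> (\<lambda>k. (1 - a ^ k) / (\<Prod>i\<in>I. 1 - x i ^ k))"
  shows "\<exists>S. ((\<lambda>\<alpha>. Ln (1 - (\<Prod>i\<in>I. x i ^ \<alpha> i) * a * t) - Ln (1 - (\<Prod>i\<in>I. x i ^ \<alpha> i) * t))
      has_sum S) (I \<rightarrow>\<^sub>E UNIV) \<and> (\<lambda>k. c k / of_nat k * t ^ k) sums S"
proof -
  define m where "m = (\<lambda>\<alpha>. \<Prod>i\<in>I. x i ^ \<alpha> i)"
  define X where "X = (I \<rightarrow>\<^sub>E (UNIV :: nat set))"
  \<comment> \<open>The index \<open>k\<close> stands for the exponent k + 1 of the logarithmic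
    series.\<close>
  define f where "f = (\<lambda>(\<alpha>, k). (1 - a ^ Suc k) * (m \<alpha> * t) ^ Suc k / of_nat (Suc k))"
  have norm_m: "norm (m \<alpha>) \<le> 1" for \<alpha>
    unfolding m_def prod_norm [symmetric]
    by (intro prod_le_1) (use assms(2) in \<open>auto simp: norm_power less_imp_le intro!: power_le_one\<close>)
  have norm_mt: "norm (m \<alpha> * t) < 1" "norm (m \<alpha> * a * t) < 1" for \<alpha>
  proof -
    have "norm (m \<alpha> * t) \<le> 1 * norm t"
      unfolding norm_mult by (intro mult_right_mono norm_m) auto
    thus 1: "norm (m \<alpha> * t) < 1"
      using assms(4) by simp
    have "norm a * norm (m \<alpha> * t) \<le> 1 * norm (m \<alpha> * t)"
      by (intro mult_right_mono) (use assms(3) in auto)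
    thus "norm (m \<alpha> * a * t) < 1"
      using 1 by (simp add: norm_mult mult_ac)
  qed
  \<comment> \<open>A majorant of \<open>f\<close> with separated variables: the 2 bounds |1 -
    a^(k+1)|, and the powers of |m| and |t| are lowered to exponents 1 and k. Its sum over \<alpha>
    is a product of geometric series in the |x_i|.\<close>
  have "(\<lambda>(\<alpha>, k). norm (m \<alpha>) * (2 * norm t ^ k)) summable_on (X \<times> UNIV)"
  proof (rule summable_on_SigmaI)
    show "((\<lambda>k. case (\<alpha>, k) of (\<alpha>, k) \<Rightarrow> norm (m \<alpha>) * (2 * norm t ^ k)) has_sum
      (norm (m \<alpha>) * (2 * (1 / (1 - norm t))))) UNIV" for \<alpha>
      unfolding prod.case
      by (intro has_sum_cmult_right norm_summable_imp_has_sum geometric_sums)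
         (use assms(4) in \<open>auto intro!: summable_geometric\<close>)
    have "(\<lambda>\<alpha>. \<Prod>i\<in>I. norm (x i) ^ \<alpha> i) summable_on X"
      using has_sum_prod_geometric[OF assms(1), of "\<lambda>i. norm (x i)"] assms(2)
      by (auto simp: X_def summable_on_def)
    thus "(\<lambda>\<alpha>. norm (m \<alpha>) * (2 * (1 / (1 - norm t)))) summable_on X"
      by (intro summable_on_cmult_left) (simp add: m_def norm_power flip: prod_norm)
  qed auto
  hence "(\<lambda>y. norm (f y)) summable_on (X \<times> UNIV)"
  proof (rule Infinite_Sum.abs_summable_on_comparison_test')
    fix y assume "y \<in> X \<times> (UNIV :: nat set)"
    obtain \<alpha> k where y: "y = (\<alpha>, k)"
      by force
    have "norm (1 - a ^ Suc k) \<le> norm (1 :: complex) + norm (a ^ Suc k)"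
      by (rule norm_triangle_ineq4)
    also have "norm (a ^ Suc k) \<le> 1"
      unfolding norm_power by (rule power_le_one) (use assms(3) in auto)
    finally have 1: "norm (1 - a ^ Suc k) \<le> 2"
      by simp
    have 2: "norm (m \<alpha>) ^ Suc k \<le> norm (m \<alpha>)"
      using power_decreasing[of 1 "Suc k" "norm (m \<alpha>)"] norm_m by simp
    have 3: "norm t ^ Suc k \<le> norm t ^ k"
      using assms(4) by (intro power_decreasing) auto
    have "norm (f y) \<le> norm ((1 - a ^ Suc k) * (m \<alpha> * t) ^ Suc k)"
    proof -
      have "norm ((1 - a ^ Suc k) * (m \<alpha> * t) ^ Suc k) / real (Suc k) \<le>
        norm ((1 - a ^ Suc k) * (m \<alpha> * t) ^ Suc k) / 1"
        by (intro divide_left_mono) auto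
      thus ?thesis
        by (simp only: f_def y prod.case norm_divide norm_of_nat div_by_1)
    qed
    also have "\<dots> = norm (1 - a ^ Suc k) * (norm (m \<alpha>) ^ Suc k * norm t ^ Suc k)"
      by (simp only: norm_mult norm_power power_mult_distrib)
    also have "\<dots> \<le> 2 * (norm (m \<alpha>) * norm t ^ k)"
      by (intro mult_mono 1 2 3) auto
    finally show "norm (f y) \<le> (case y of (\<alpha>, k) \<Rightarrow> norm (m \<alpha>) * (2 * norm t ^ k))"
      by (simp add: y mult_ac)
  qed
  hence "f summable_on (X \<times> UNIV)"
    by (rule abs_summable_summable)
  then obtain S where S: "(f has_sum S) (X \<times> UNIV)"
    by (auto simp: summable_on_def)
  \<comment> \<open>Summing over k first gives the difference of two logarithmic series.\<close>
  have "((\<lambda>\<alpha>. Ln (1 - m \<alpha> * a * t) - Ln (1 - m \<alpha> * t)) has_sum S) X"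
  proof (rule has_sum_SigmaD[OF S])
    fix \<alpha>
    have "((\<lambda>k. (m \<alpha> * t) ^ Suc k / of_nat (Suc k) + - ((m \<alpha> * a * t) ^ Suc k / of_nat (Suc k)))
      has_sum (- Ln (1 - m \<alpha> * t) + - (- Ln (1 - m \<alpha> * a * t)))) UNIV"
      by (intro has_sum_add has_sum_uminusI has_sum_Ln_series norm_mt)
    also have "(\<lambda>k. (m \<alpha> * t) ^ Suc k / of_nat (Suc k) + - ((m \<alpha> * a * t) ^ Suc k / of_nat (Suc k)))
      = (\<lambda>k. f (\<alpha>, k))"
      by (simp add: f_def fun_eq_iff power_mult_distrib diff_divide_distrib algebra_simps
               del: of_nat_Suc power_Suc)
    finally show "((\<lambda>k. f (\<alpha>, k)) has_sum (Ln (1 - m \<alpha> * a * t) - Ln (1 - m \<alpha> * t))) UNIV"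
      by simp
  qed
  \<comment> \<open>Summing over \<alpha> first: the (k+1)-st power of the monomial
    \<open>m \<alpha>\<close> is the same monomial in the numbers \<open>x i ^ Suc k\<close>, which
    gives geometric series again.\<close>
  moreover have "((\<lambda>k. c (Suc k) / of_nat (Suc k) * t ^ Suc k) has_sum S) UNIV"
  proof (rule has_sum_SigmaD)
    show "((\<lambda>(k, \<alpha>). f (\<alpha>, k)) has_sum S) (UNIV \<times> X)"
      using S by (subst (asm) has_sum_swap)
  next
    fix k
    have "norm (x i ^ Suc k) < 1" if "i \<in> I" for i
      using power_decreasing[of 1 "Suc k" "norm (x i)"] assms(2)[OF that] by (simp add: norm_power norm_mult)
    hence "((\<lambda>\<alpha>. \<Prod>i\<in>I. (x i ^ Suc k) ^ \<alpha> i) has_sum (\<Prod>i\<in>I. 1 / (1 - x i ^ Suc k))) X"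
      unfolding X_def by (intro has_sum_prod_geometric assms(1))
    hence "((\<lambda>\<alpha>. (1 - a ^ Suc k) * t ^ Suc k / of_nat (Suc k) * (\<Prod>i\<in>I. (x i ^ Suc k) ^ \<alpha> i))
      has_sum ((1 - a ^ Suc k) * t ^ Suc k / of_nat (Suc k) * (\<Prod>i\<in>I. 1 / (1 - x i ^ Suc k)))) X"
      by (rule has_sum_cmult_right)
    also have "(\<lambda>\<alpha>. (1 - a ^ Suc k) * t ^ Suc k / of_nat (Suc k) * (\<Prod>i\<in>I. (x i ^ Suc k) ^ \<alpha> i))
      = (\<lambda>\<alpha>. f (\<alpha>, k))"
      by (simp add: f_def m_def fun_eq_iff power_mult_distrib power_commutes prod_power_distrib
               mult.commute flip: power_mult del: of_nat_Suc power_Suc)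
    also have "(1 - a ^ Suc k) * t ^ Suc k / of_nat (Suc k) * (\<Prod>i\<in>I. 1 / (1 - x i ^ Suc k)) =
      c (Suc k) / of_nat (Suc k) * t ^ Suc k"
      by (simp add: c_def prod_dividef del: of_nat_Suc power_Suc)
    finally show "((\<lambda>\<alpha>. case (k, \<alpha>) of (k, \<alpha>) \<Rightarrow> f (\<alpha>, k)) has_sum
      (c (Suc k) / of_nat (Suc k) * t ^ Suc k)) X"
      by simp
  qed
  hence "(\<lambda>k. c k / of_nat k * t ^ k) sums S"
    using sums_Suc_iff[of "\<lambda>k. c k / of_nat k * t ^ k" S] by (auto dest: has_sum_imp_sums)
  ultimately show ?thesis
    unfolding m_def X_def by blast
qed

subsection \<open>The product formula\<close>

text \<open>Continuity of exp carries the net of finite sums to the net of finite products. The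
  limit is nonzero, so no factor has to be split off.\<close>

lemma has_prod_on_exp:
  fixes f :: "'i \<Rightarrow> complex"
  assumes "(g has_sum S) X" "\<And>y. y \<in> X \<Longrightarrow> f y = exp (g y)"
  shows "has_prod_on f (exp S) X"
proof -
  have "((\<lambda>F. exp (sum g F)) \<longlongrightarrow> exp S) (finite_subsets_at_top X)"
    using assms(1) unfolding has_sum_def by (intro tendsto_exp)
  moreover have "\<forall>\<^sub>F F in finite_subsets_at_top X. exp (sum g F) = prod f F"
    by (rule eventually_finite_subsets_at_top_weakI)
       (use assms(2) in \<open>auto simp: exp_sum subset_iff intro!: prod.cong\<close>)
  ultimately have "(prod f \<longlongrightarrow> exp S) (finite_subsets_at_top X)"
    by (rule Lim_transform_eventually)
  thus ?thesis
    unfolding has_prod_on_def by (intro exI[of _ "{}"] exI[of _ "exp S"]) auto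
qed

text \<open>The exponential of \<open>eval_fps G\<close> is holomorphic on the convergence disc of
  \<open>G\<close>, so its Taylor series converges to it on that whole disc; the coefficients are
  those of the formal composition.\<close>

lemma sums_fps_exp_compose:
  fixes G :: "complex fps"
  assumes "fps_nth G 0 = 0" "ereal (norm t) < fps_conv_radius G"
  shows "(\<lambda>k. fps_nth (fps_exp 1 oo G) k * t ^ k) sums exp (eval_fps G t)"
proof -
  have "0 < fps_conv_radius G"
    using assms(2) by (rule le_less_trans[rotated]) simp
  hence "(exp \<circ> eval_fps G) has_fps_expansion (fps_exp 1 oo G)"
    using assms(1)
    by (intro has_fps_expansion_compose has_fps_expansion_exp1 eval_fps_has_fps_expansion) auto
  moreover have "(exp \<circ> eval_fps G) holomorphic_on eball 0 (fps_conv_radius G)"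
    unfolding o_def by (intro holomorphic_intros) auto
  ultimately show ?thesis
    using has_fps_expansion_imp_sums_complex[OF _ _ assms(2)] by force
qed

theorem theorem2p1:
  fixes n :: nat and x :: "nat \<Rightarrow> complex" and a t :: complex
  assumes "n \<ge> 1"
    and "\<And>l. l \<in> {1..n} \<Longrightarrow> norm (x l) < 1"
    and "norm a < 1"
    and "norm t < 1"
  shows "summable (\<lambda>k. A_coeff n x a k * t ^ k) \<and>
    has_prod_on
      (\<lambda>\<alpha>. (1 - (\<Prod>l = 1..n. x l ^ \<alpha> l) * a * t) / (1 - (\<Prod>l = 1..n. x l ^ \<alpha> l) * t))
      (\<Sum>k. A_coeff n x a k * t ^ k)
      (exponent_tuples n)"
proof -
  define c where "c = (\<lambda>k. (1 - a ^ k) / (\<Prod>l = 1..n. 1 - x l ^ k))"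
  define G where "G = Abs_fps (\<lambda>k. c k / of_nat k)"
  define H where "H = fps_exp 1 oo G"
  define m where "m = (\<lambda>\<alpha>. \<Prod>l = 1..n. x l ^ \<alpha> l)"
  have G_0: "fps_nth G 0 = 0"
    by (simp add: G_def)
  have A_eq: "A_coeff n x a k = fps_nth H k" for k
  proof -
    \<comment> \<open>Passing to indices from 0 leaves i - j unchanged but turns the superdiagonal
      entry -i into -(i + 1).\<close>
    have "Determinant.det (mat k k (\<lambda>(i, j). a_entry n x a (i + 1) (j + 1))) =
      Determinant.det (mat k k (\<lambda>(i, j).
        if j \<le> i then c (i - j + 1) else if i + 1 = j then - of_nat (i + 1) else 0))"
      by (intro arg_cong[where f = Determinant.det] eq_matI) (auto simp: a_entry_def c_def)
    also have "\<dots> = fact k * fps_nth H k"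
    proof (rule det_hessenberg)
      show "fps_nth H 0 = 1"
        by (simp add: H_def)
      show "of_nat (Suc m) * fps_nth H (Suc m) = (\<Sum>j\<le>m. c (m - j + 1) * fps_nth H j)" for m
        unfolding H_def fps_exp_compose_nth_Suc[OF G_0]
        by (intro sum.cong) (simp_all add: G_def del: of_nat_Suc)
    qed
    finally show ?thesis
      by (simp add: A_coeff_def H_def)
  qed
  \<comment> \<open>The logarithm lemma, applied with every real r in (0,1) in place of
    \<open>t\<close>, yields convergence at r.\<close>
  have "fps_conv_radius G \<ge> 1"
    unfolding fps_conv_radius_def
  proof (rule conv_radius_geI_ex')
    fix r :: real assume "0 < r" "ereal r < 1"
    hence "norm (of_real r :: complex) < 1"
      by simp
    then obtain S where "(\<lambda>k. c k / of_nat k * of_real r ^ k) sums S"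
      using has_sum_Ln_factors[of "{1..n}" x a "of_real r", OF finite_atLeastAtMost assms(2,3)]
      unfolding c_def by blast
    thus "summable (\<lambda>k. fps_nth G k * of_real r ^ k)"
      by (simp add: G_def sums_iff)
  qed
  hence radius: "ereal (norm t) < fps_conv_radius G"
    using assms(4) by (metis ereal_less(3) less_le_trans)
  obtain S where S: "((\<lambda>\<alpha>. Ln (1 - m \<alpha> * a * t) - Ln (1 - m \<alpha> * t)) has_sum S) (exponent_tuples n)"
      "(\<lambda>k. c k / of_nat k * t ^ k) sums S"
    using has_sum_Ln_factors[of "{1..n}" x a t, OF finite_atLeastAtMost assms(2-4)]
    unfolding m_def c_def exponent_tuples_def by blast
  have "eval_fps G t = S"
    using S(2) by (simp add: eval_fps_def G_def sums_iff)
  hence sums: "(\<lambda>k. A_coeff n x a k * t ^ k) sums exp S"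
    unfolding A_eq H_def using sums_fps_exp_compose[OF G_0 radius] by simp
  \<comment> \<open>Taking \<open>b = a\<close> and \<open>b = 1\<close> covers numerators and
    denominators; nonvanishing is what allows exp to undo \<open>Ln\<close>.\<close>
  have nz: "1 - m \<alpha> * b * t \<noteq> 0" if "norm b \<le> 1" for \<alpha> b
  proof
    assume "1 - m \<alpha> * b * t = 0"
    hence "1 = norm (m \<alpha>) * norm b * norm t"
      by (metis eq_iff_diff_eq_0 norm_mult norm_one)
    also have "norm (m \<alpha>) \<le> 1"
      unfolding m_def prod_norm [symmetric]
      by (intro prod_le_1) (use assms(2) in \<open>auto simp: norm_power less_imp_le intro!: power_le_one\<close>)
    hence "norm (m \<alpha>) * norm b * norm t \<le> 1 * 1 * norm t"
      using that by (intro mult_mono) auto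
    finally show False
      using assms(4) by simp
  qed
  have "has_prod_on (\<lambda>\<alpha>. (1 - m \<alpha> * a * t) / (1 - m \<alpha> * t)) (exp S) (exponent_tuples n)"
    by (rule has_prod_on_exp[OF S(1)])
       (use nz[of a] nz[of 1] assms(3) in \<open>simp add: exp_diff\<close>)
  thus ?thesis
    using sums by (simp add: sums_iff m_def)
qed

end
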